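(* Let $a,b,c\in\mathbb{N}$. If $a+b+c$ is odd, then $\zeta_2((a,b,c);PU(3))$ can be expressed as a polynomial in $\{\phi(j,h/3)\,:\,h\in\{0,1,2\},\ j\in\mathbb{N}\}$ with coefficients in $\mathbb{Q}[\pi,i]$.
   Context: $\zeta_2((s_1,s_2,s_3);PU(3))=\sum_{m,n\ge1,\ m\equiv n\ (\mathrm{mod}\ 3)}\frac{1}{m^{s_1}n^{s_2}(m+n)^{s_3}}$. $\phi(s,\alpha)=\sum_{m\ge1}e^{2\pi im\alpha}m^{-s}$ is the Lerch zeta-function. *)

theory Defs
  imports
    "HOL-Analysis.Analysis"
    "HOL-Number_Theory.Cong"
    "HOL-Library.Poly_Mapping"
begin

(* On the region of absolute convergence only; outside of it infsum is 0 by convention. *)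
definition zeta2_PU3 :: "complex \<times> complex \<times> complex \<Rightarrow> complex" where
  "zeta2_PU3 = (\<lambda>(s1, s2, s3).
     \<Sum>\<^sub>\<infinity>(m, n)\<in>{(m, n). m \<ge> 1 \<and> n \<ge> 1 \<and> [m = n] (mod 3)}.
       1 / (of_nat m powr s1 * of_nat n powr s2 * of_nat (m + n) powr s3))"

(* The sum is over m = Suc k \<ge> 1 and is taken in the natural order, since for s = 1 it converges
   only conditionally (and only for non-integral \<alpha>). *)
definition lerch_phi :: "complex \<Rightarrow> real \<Rightarrow> complex" where
  "lerch_phi s \<alpha> =
     suminf (\<lambda>k.
       exp (2 * of_real pi * \<i> * of_nat (Suc k) * of_real \<alpha>) * of_nat (Suc k) powr (- s))"

(* A multivariate polynomial is a finitely supported map from monomials to coefficients, and a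
   monomial is a finitely supported map from indeterminates to exponents. *)
definition mpoly_eval ::
  "('v \<Rightarrow> 'a) \<Rightarrow> (('v \<Rightarrow>\<^sub>0 nat) \<Rightarrow>\<^sub>0 'a) \<Rightarrow> 'a::comm_semiring_1" where
  "mpoly_eval x p =
     (\<Sum>m\<in>Poly_Mapping.keys p.
        Poly_Mapping.lookup p m * (\<Prod>v\<in>Poly_Mapping.keys m. x v ^ Poly_Mapping.lookup m v))"

(* K[S]: the values of all polynomials with coefficients in K in the elements of S.  The
   indeterminates are indexed by the elements of S themselves, hence evaluation at the identity. *)
definition adjoin :: "'a::comm_semiring_1 set \<Rightarrow> 'a set \<Rightarrow> 'a set" where
  "adjoin K S = {mpoly_eval (\<lambda>t. t) p | p.
     (\<forall>m. Poly_Mapping.lookup p m \<in> K) \<and>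
     (\<forall>m\<in>Poly_Mapping.keys p. Poly_Mapping.keys m \<subseteq> S)}"

(* The pair j = 1, h = 0 is left out: \<phi>(s, 0) is the Riemann zeta function, which has a pole
   at s = 1. *)
definition lerch_values :: "complex set" where
  "lerch_values = {lerch_phi (of_nat j) (real h / 3) | j h :: nat.
     j \<ge> 1 \<and> h \<in> {0, 1, 2} \<and> \<not> (j = 1 \<and> h = 0)}"

end

theory Submission
  imports Defs
begin

text \<open>Write \<open>X(a,b,c)\<close> for the double series. Summing \<open>1/(m^a n^b l^c)\<close> over all
  nonzero integers \<open>m \<equiv> n (mod 3)\<close> with \<open>l = m + n > 0\<close> and separating the signs of \<open>m\<close> and
  \<open>n\<close> gives \<open>X(a,b,c) + (-1)^b X(b,c,a) + (-1)^a X(c,a,b)\<close>, because \<open>m \<equiv> n (mod 3)\<close> is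
  invariant under cyclic permutation of \<open>(m, n, -l)\<close>. On the other hand, repeated use of
  \<open>1/(m n) = (1/m + 1/n)/l\<close> reduces the inner sum over \<open>m\<close> to sums of \<open>m^-j\<close> over a full
  residue class modulo 3, which by orthogonality of characters are combinations of the values
  \<open>\<phi>(j, h/3)\<close>; so the whole expression is a polynomial in Lerch values. When \<open>a + b + c\<close> is
  odd, two of its cyclic shifts can be combined such that only \<open>X(a,b,c)\<close> remains.\<close>

section \<open>Adjoining elements to a semiring\<close>

text \<open>Matches the generality of \<open>adjoin\<close>, which lives in commutative semirings.
  Being inherited by \<open>adjoin\<close>, it serves both layers of the nested ring; differences
  come later from the rational number -1.\<close>

definition subsemiring :: "'a::comm_semiring_1 set \<Rightarrow> bool" where
  "subsemiring K \<longleftrightarrow> 0 \<in> K \<and> 1 \<in> K \<and> (\<forall>x\<in>K. \<forall>y\<in>K. x + y \<in> K \<and> x * y \<in> K)"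

definition monomial_eval :: "('v \<Rightarrow> 'a) \<Rightarrow> ('v \<Rightarrow>\<^sub>0 nat) \<Rightarrow> 'a::comm_semiring_1" where
  "monomial_eval x m = (\<Prod>v\<in>Poly_Mapping.keys m. x v ^ Poly_Mapping.lookup m v)"

text \<open>Indices outside the keys have exponent 0 and contribute the factor 1. Thus two monomials
  can be evaluated over a common index set.\<close>

lemma monomial_eval_superset:
  assumes "finite A" "Poly_Mapping.keys m \<subseteq> A"
  shows "monomial_eval x m = (\<Prod>v\<in>A. x v ^ Poly_Mapping.lookup m v)"
  unfolding monomial_eval_def
  by (intro prod.mono_neutral_left assms) (auto simp: in_keys_iff)

lemma monomial_eval_add: "monomial_eval x (m + m') = monomial_eval x m * monomial_eval x m'"
proof -
  define A where "A = Poly_Mapping.keys m \<union> Poly_Mapping.keys m'"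
  have "finite A" by (simp add: A_def)
  moreover have "Poly_Mapping.keys (m + m') \<subseteq> A"
    unfolding A_def by (rule Poly_Mapping.keys_add)
  ultimately show ?thesis
    by (simp add: monomial_eval_superset[of A] A_def lookup_add power_add prod.distrib)
qed

lemma mpoly_eval_superset:
  assumes "finite A" "Poly_Mapping.keys p \<subseteq> A"
  shows "mpoly_eval x p = (\<Sum>m\<in>A. Poly_Mapping.lookup p m * monomial_eval x m)"
  unfolding mpoly_eval_def monomial_eval_def[symmetric]
  by (intro sum.mono_neutral_left assms) (auto simp: in_keys_iff)

lemma mpoly_eval_add: "mpoly_eval x (p + q) = mpoly_eval x p + mpoly_eval x q"
proof -
  define A where "A = Poly_Mapping.keys p \<union> Poly_Mapping.keys q"
  have "finite A" by (simp add: A_def)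
  moreover have "Poly_Mapping.keys (p + q) \<subseteq> A"
    unfolding A_def by (rule Poly_Mapping.keys_add)
  ultimately show ?thesis
    by (simp add: mpoly_eval_superset[of A] A_def lookup_add distrib_right sum.distrib)
qed

lemma mpoly_eval_single: "mpoly_eval x (Poly_Mapping.single m c) = c * monomial_eval x m"
  by (subst mpoly_eval_superset[of "{m}"]) auto

lemma adjoinI_single:
  assumes "0 \<in> K" "c \<in> K" "Poly_Mapping.keys m \<subseteq> S"
  shows "c * monomial_eval (\<lambda>t. t) m \<in> adjoin K S"
  unfolding adjoin_def mem_Collect_eq
  by (rule exI[of _ "Poly_Mapping.single m c"])
     (use assms in \<open>auto simp: mpoly_eval_single lookup_single when_def\<close>)

lemma adjoin_add:
  assumes "subsemiring K" "x \<in> adjoin K S" "y \<in> adjoin K S"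
  shows "x + y \<in> adjoin K S"
proof -
  obtain p q where "x = mpoly_eval (\<lambda>t. t) p" "y = mpoly_eval (\<lambda>t. t) q"
    and *: "\<forall>m. Poly_Mapping.lookup p m \<in> K" "\<forall>m\<in>Poly_Mapping.keys p. Poly_Mapping.keys m \<subseteq> S"
    "\<forall>m. Poly_Mapping.lookup q m \<in> K" "\<forall>m\<in>Poly_Mapping.keys q. Poly_Mapping.keys m \<subseteq> S"
    using assms(2,3) unfolding adjoin_def by blast
  hence "x + y = mpoly_eval (\<lambda>t. t) (p + q)" by (simp add: mpoly_eval_add)
  moreover have "\<forall>m. Poly_Mapping.lookup (p + q) m \<in> K"
    using * assms(1) by (simp add: lookup_add subsemiring_def)
  moreover have "\<forall>m\<in>Poly_Mapping.keys (p + q). Poly_Mapping.keys m \<subseteq> S"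
    using * Poly_Mapping.keys_add[of p q] by blast
  ultimately show ?thesis unfolding adjoin_def by blast
qed

lemma adjoin_sum:
  assumes "subsemiring K" "\<And>i. i \<in> I \<Longrightarrow> f i \<in> adjoin K S"
  shows "sum f I \<in> adjoin K S"
proof -
  have "0 \<in> adjoin K S"
    using assms(1) adjoinI_single[of K 0 0 S] by (simp add: subsemiring_def)
  thus ?thesis
    using assms(2) by (induction I rule: infinite_finite_induct) (auto intro: adjoin_add assms(1))
qed

text \<open>Expanding both values gives a finite double sum whose summands are values of one-term
  polynomials; closure under sums does the rest. The product polynomial itself is never
  formed.\<close>

lemma adjoin_mult:
  assumes K: "subsemiring K" and "x \<in> adjoin K S" "y \<in> adjoin K S"
  shows "x * y \<in> adjoin K S"
proof -
  obtain p q where x: "x = mpoly_eval (\<lambda>t. t) p" and y: "y = mpoly_eval (\<lambda>t. t) q"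
    and *: "\<forall>m. Poly_Mapping.lookup p m \<in> K" "\<forall>m\<in>Poly_Mapping.keys p. Poly_Mapping.keys m \<subseteq> S"
    "\<forall>m. Poly_Mapping.lookup q m \<in> K" "\<forall>m\<in>Poly_Mapping.keys q. Poly_Mapping.keys m \<subseteq> S"
    using assms(2,3) unfolding adjoin_def by blast
  have "x * y = (\<Sum>m\<in>Poly_Mapping.keys p. \<Sum>m'\<in>Poly_Mapping.keys q.
      (Poly_Mapping.lookup p m * Poly_Mapping.lookup q m') * monomial_eval (\<lambda>t. t) (m + m'))"
    unfolding x y mpoly_eval_def monomial_eval_def[symmetric] monomial_eval_add sum_product
    by (simp add: algebra_simps)
  moreover have "(Poly_Mapping.lookup p m * Poly_Mapping.lookup q m') *
      monomial_eval (\<lambda>t. t) (m + m') \<in> adjoin K S"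
    if "m \<in> Poly_Mapping.keys p" "m' \<in> Poly_Mapping.keys q" for m m'
  proof (rule adjoinI_single)
    show "Poly_Mapping.keys (m + m') \<subseteq> S"
      using * that Poly_Mapping.keys_add[of m m'] by blast
  qed (use K * in \<open>auto simp: subsemiring_def\<close>)
  ultimately show ?thesis by (auto intro!: adjoin_sum[OF K])
qed

lemma base_subset_adjoin:
  assumes "subsemiring K"
  shows "K \<subseteq> adjoin K S"
  using assms adjoinI_single[of K _ 0 S] by (auto simp: subsemiring_def monomial_eval_def)

lemma generators_subset_adjoin:
  assumes "subsemiring K"
  shows "S \<subseteq> adjoin K S"
  using assms adjoinI_single[of K 1 "Poly_Mapping.single _ 1" S]
  by (auto simp: subsemiring_def monomial_eval_def)

lemma subsemiring_adjoin: "subsemiring K \<Longrightarrow> subsemiring (adjoin K S)"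
  unfolding subsemiring_def[of "adjoin K S"]
  using base_subset_adjoin[of K S] by (auto simp: subsemiring_def intro: adjoin_add adjoin_mult)

section \<open>Cubic Lerch series\<close>

text \<open>Summation by parts: for \<open>g k\<close> = z^k / ((z - 1)(k + 1)), the difference
  \<open>g (Suc k) - g k\<close> is z^k / (k + 2) minus z^k / ((z - 1)(k + 1)(k + 2)). The
  difference telescopes with \<open>g\<close> tending to 0, and the error term is absolutely
  summable.\<close>

lemma summable_power_over_Suc:
  fixes z :: complex
  assumes z: "norm z = 1" "z \<noteq> 1"
  shows "summable (\<lambda>k. z ^ k / of_nat (Suc k))"
proof -
  define g where "g = (\<lambda>k. z ^ k / (z - 1) / of_nat (Suc k))"
  have "(\<lambda>k. norm (g k)) = (\<lambda>k. inverse (norm (z - 1)) * inverse (real (Suc k)))"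
    by (simp only: g_def norm_divide norm_power norm_of_nat z) (simp add: divide_inverse)
  hence "(\<lambda>k. norm (g k)) \<longlonglongrightarrow> 0"
    using tendsto_mult_right_zero[OF LIMSEQ_inverse_real_of_nat] by simp
  hence "summable (\<lambda>k. g (Suc k) - g k)"
    by (rule telescope_summable[OF tendsto_norm_zero_cancel])
  moreover have "summable (\<lambda>k. z ^ k / (z - 1) / (of_nat (Suc k) * of_nat (Suc (Suc k))))"
  proof (rule summable_comparison_test'[of "\<lambda>k. inverse (norm (z - 1)) * inverse (real (Suc k) ^ 2)"])
    show "summable (\<lambda>k. inverse (norm (z - 1)) * inverse (real (Suc k) ^ 2))"
      using inverse_power_summable[of 2, where 'a = real]
      by (intro summable_mult) (subst summable_Suc_iff, simp)
    show "norm (z ^ k / (z - 1) / (of_nat (Suc k) * of_nat (Suc (Suc k))))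
      \<le> inverse (norm (z - 1)) * inverse (real (Suc k) ^ 2)" for k
    proof -
      have "inverse (real (Suc k) * real (Suc (Suc k))) \<le> inverse (real (Suc k) ^ 2)"
        unfolding power2_eq_square by (intro le_imp_inverse_le mult_left_mono) auto
      thus ?thesis
        by (simp only: norm_divide norm_mult norm_power norm_of_nat z)
           (simp only: divide_inverse power_one mult_1, intro mult_left_mono, auto)
    qed
  qed
  ultimately have "summable (\<lambda>k. (g (Suc k) - g k) +
      z ^ k / (z - 1) / (of_nat (Suc k) * of_nat (Suc (Suc k))))"
    by (rule summable_add)
  moreover have "(g (Suc k) - g k) + z ^ k / (z - 1) / (of_nat (Suc k) * of_nat (Suc (Suc k)))
      = z ^ k / of_nat (Suc (Suc k))" for k
  proof -
    have nz: "of_nat (Suc k) \<noteq> (0::complex)" "of_nat (Suc (Suc k)) \<noteq> (0::complex)" "z - 1 \<noteq> 0"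
      using z by (simp_all only: of_nat_eq_0_iff) auto
    have "of_nat (Suc (Suc k)) = (of_nat (Suc k) + 1 :: complex)" by simp
    with nz show ?thesis
      unfolding g_def by (simp add: divide_simps del: of_nat_Suc) (simp add: algebra_simps del: of_nat_Suc)
  qed
  \<comment> \<open>The extra factor \<open>z\<close> turns the series just obtained into the
    desired one with its first term removed.\<close>
  ultimately have "summable (\<lambda>k. z * (z ^ k / of_nat (Suc (Suc k))))"
    by (intro summable_mult) simp
  hence "summable (\<lambda>k. (\<lambda>k. z ^ k / of_nat (Suc k)) (Suc k))" by simp
  thus ?thesis by (subst (asm) summable_Suc_iff)
qed

section \<open>The primitive cube root of unity\<close>

definition \<omega> :: complex where "\<omega> = cis (2 * pi / 3)"

lemma omega_cube: "\<omega> ^ 3 = 1"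
  unfolding \<omega>_def Complex.DeMoivre by simp

lemma omega_ne_1: "\<omega> \<noteq> 1"
  by (simp add: \<omega>_def complex_eq_iff cos_120)

lemma omega_sum: "1 + \<omega> + \<omega> ^ 2 = 0"
proof -
  have "(\<omega> - 1) * (1 + \<omega> + \<omega> ^ 2) = 0"
    using omega_cube by (simp add: algebra_simps power2_eq_square power3_eq_cube)
  thus ?thesis using omega_ne_1 by simp
qed

lemma norm_omega: "norm \<omega> = 1"
  by (simp add: \<omega>_def)

lemma omega_power_mod: "\<omega> ^ n = \<omega> ^ (n mod 3)"
proof -
  have "\<omega> ^ n = \<omega> ^ (3 * (n div 3) + n mod 3)"
    by (simp only: mult_div_mod_eq)
  also have "\<dots> = \<omega> ^ (n mod 3)"
    by (simp only: power_add power_mult omega_cube power_one mult_1)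
  finally show ?thesis .
qed

text \<open>Divided by 3, this is the indicator of the multiples of 3 as a sum of characters; it is
  what turns residue classes into Lerch series.\<close>

lemma omega_orthogonality:
  "1 + \<omega> ^ n + \<omega> ^ (2 * n) = (if 3 dvd n then 3 else 0)"
proof -
  define r where "r = n mod 3"
  have *: "\<omega> ^ n = \<omega> ^ r" "\<omega> ^ (2 * n) = \<omega> ^ (r * 2)"
    using omega_power_mod[of n] unfolding r_def by (simp, metis mult.commute power_mult)
  have "\<omega> ^ 4 = \<omega>" using omega_power_mod[of 4] by simp
  moreover have "r = 0 \<or> r = 1 \<or> r = 2" unfolding r_def by linarith
  ultimately have "1 + \<omega> ^ r + \<omega> ^ (r * 2) = (if r = 0 then 3 else 0)"
    using omega_sum by (elim disjE) (simp_all add: add_ac power2_eq_square)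
  thus ?thesis unfolding * by (simp add: r_def dvd_eq_mod_eq_0)
qed

section \<open>Lerch values at arguments in thirds\<close>

definition lerch3 :: "nat \<Rightarrow> nat \<Rightarrow> complex" where
  "lerch3 h j = lerch_phi (of_nat j) (real h / 3)"

text \<open>The summands agree term by term, so the two \<open>suminf\<close> expressions coincide
  whether or not the series converge.\<close>

lemma lerch3_conv_suminf: "lerch3 h j = suminf (\<lambda>k. \<omega> ^ (h * Suc k) / of_nat (Suc k) ^ j)"
proof -
  have "exp (2 * of_real pi * \<i> * of_nat (Suc k) * of_real (real h / 3)) * of_nat (Suc k) powr (- of_nat j)
      = \<omega> ^ (h * Suc k) / of_nat (Suc k) ^ j" for k
  proof -
    have "exp (2 * of_real pi * \<i> * of_nat (Suc k) * of_real (real h / 3)) = \<omega> ^ (h * Suc k)"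
      unfolding \<omega>_def Complex.DeMoivre unfolding cis_conv_exp
      by (rule arg_cong[where f = exp]) (simp, simp only: distrib_left mult_1_right)
    moreover have "of_nat (Suc k) powr (- of_nat j) = inverse (of_nat (Suc k) ^ j :: complex)"
      by (subst powr_minus, subst powr_nat') (simp_all del: of_nat_Suc)
    ultimately show ?thesis by (simp only: divide_inverse)
  qed
  thus ?thesis unfolding lerch3_def lerch_phi_def by (simp only:)
qed

lemma summable_norm_lerch3:
  assumes "j \<ge> 2"
  shows "summable (\<lambda>k. norm (\<omega> ^ (h * Suc k) / of_nat (Suc k) ^ j))"
proof -
  have "summable (\<lambda>k. inverse (real (Suc k) ^ j))"
    using inverse_power_summable[OF assms, where 'a = real] by (subst summable_Suc_iff) simp
  thus ?thesis
    by (simp only: norm_divide norm_power norm_omega norm_of_nat power_one) (simp add: divide_inverse)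
qed

lemma lerch3_sums:
  assumes "j \<ge> 1" "h \<in> {0, 1, 2}" "\<not> (j = 1 \<and> h = 0)"
  shows "(\<lambda>k. \<omega> ^ (h * Suc k) / of_nat (Suc k) ^ j) sums lerch3 h j"
proof -
  have "summable (\<lambda>k. \<omega> ^ (h * Suc k) / of_nat (Suc k) ^ j)"
  proof (cases "j = 1")
    case True
    \<comment> \<open>Otherwise the character sum for \<open>h\<close> equals 3, so 3 divides
      \<open>h\<close> and \<open>h = 0\<close>, which is the excluded pole.\<close>
    have "\<omega> ^ h \<noteq> 1"
    proof
      assume "\<omega> ^ h = 1"
      moreover from this have "\<omega> ^ (2 * h) = 1" by (metis mult.commute power_mult power_one)
      ultimately have "3 dvd h" using omega_orthogonality[of h] by (simp split: if_splits)
      thus False using assms True by auto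
    qed
    hence "summable (\<lambda>k. \<omega> ^ h * ((\<omega> ^ h) ^ k / of_nat (Suc k)))"
      by (intro summable_mult summable_power_over_Suc) (simp_all add: norm_power norm_omega)
    thus ?thesis by (simp add: True power_add power_mult)
  next
    case False
    thus ?thesis using assms by (intro summable_norm_cancel[OF summable_norm_lerch3]) auto
  qed
  thus ?thesis unfolding lerch3_conv_suminf by (rule summable_sums)
qed

text \<open>Unordered summation asks for absolute convergence, hence the exponent is at least 2
  here.\<close>

lemma lerch3_has_sum:
  assumes "j \<ge> 2" "h \<in> {0, 1, 2}"
  shows "((\<lambda>n. \<omega> ^ (h * n) / of_nat n ^ j) has_sum lerch3 h j) {1..}"
proof -
  have "((\<lambda>k. \<omega> ^ (h * Suc k) / of_nat (Suc k) ^ j) has_sum lerch3 h j) UNIV"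
    using assms by (intro norm_summable_imp_has_sum summable_norm_lerch3 lerch3_sums) auto
  moreover have "bij_betw Suc UNIV {1..}"
    by (rule bij_betwI[of _ _ _ "\<lambda>n. n - 1"]) auto
  ultimately show ?thesis
    using has_sum_reindex_bij_betw[of Suc UNIV "{1..}" "\<lambda>n. \<omega> ^ (h * n) / of_nat n ^ j"] by simp
qed

section \<open>Partial fractions\<close>

text \<open>For fixed \<open>l\<close> the second variable is n = l - m. Then m congruent to n
  modulo 3 means that 3 divides 2m - l, equivalently m + l; the two removed points are the zeros of
  m and of n.\<close>

definition fibre :: "nat \<Rightarrow> int set" where
  "fibre l = {m. m \<noteq> 0 \<and> m \<noteq> int l \<and> 3 dvd m + int l}"

text \<open>The truncation is invariant under \<open>m \<mapsto> l - m\<close> and still makes the sum for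
  \<open>a + b = 1\<close> converge, although that one is not absolutely convergent.\<close>

definition fibre_sum :: "nat \<Rightarrow> nat \<Rightarrow> nat \<Rightarrow> nat \<Rightarrow> complex" where
  "fibre_sum a b l N = (\<Sum>m\<in>fibre l \<inter> {- int N..int l + int N}.
     1 / (of_int m ^ a * of_int (int l - m) ^ b))"

lemma fibre_sum_commute: "fibre_sum a b l N = fibre_sum b a l N"
proof -
  have "3 dvd int l - m + int l" if "3 dvd m + int l" for m
  proof -
    have "3 dvd 3 * int l - (m + int l)" using that by (intro dvd_diff) auto
    thus ?thesis by (simp add: algebra_simps)
  qed
  thus ?thesis
    unfolding fibre_sum_def fibre_def
    by (intro sum.reindex_bij_witness[of _ "\<lambda>m. int l - m" "\<lambda>m. int l - m"]) (auto simp: mult.commute)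
qed

text \<open>The identity 1/(x y) = (1/x + 1/y)/(x + y) with x = m and y = l - m: the denominator x +
  y = l is constant on the fibre, so the recursion already holds for every truncation.\<close>

lemma fibre_sum_Suc_Suc:
  assumes "l \<ge> 1"
  shows "fibre_sum (Suc a) (Suc b) l N =
    (fibre_sum a (Suc b) l N + fibre_sum (Suc a) b l N) / of_nat l"
proof -
  have "1 / (of_int m ^ Suc a * of_int (int l - m) ^ Suc b) =
      (1 / (of_int m ^ a * of_int (int l - m) ^ Suc b) +
       1 / (of_int m ^ Suc a * of_int (int l - m) ^ b)) / (of_nat l :: complex)"
    if "m \<in> fibre l" for m
  proof -
    have pf: "1 / (x ^ Suc a * y ^ Suc b) = (1 / (x ^ a * y ^ Suc b) + 1 / (x ^ Suc a * y ^ b)) / z"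
      if "x \<noteq> 0" "y \<noteq> 0" "z \<noteq> 0" "z = x + y" for x y z :: complex
      using that by (simp add: divide_simps)
    have "of_int m \<noteq> (0::complex)" "of_int (int l - m) \<noteq> (0::complex)" "of_nat l \<noteq> (0::complex)"
      using that assms unfolding fibre_def by (simp_all only: of_int_eq_0_iff of_nat_eq_0_iff) auto
    thus ?thesis by (rule pf) simp
  qed
  thus ?thesis
    unfolding fibre_sum_def by (simp add: sum.distrib[symmetric] sum_divide_distrib)
qed

lemma sum_lessThan_add:
  fixes f :: "nat \<Rightarrow> 'a::comm_monoid_add"
  shows "sum f {..<n + l} = sum f {..<n} + (\<Sum>i<l. f (n + i))"
  by (induction l) (simp_all add: add_ac)

text \<open>Folding m and -m together produces the sign \<open>\<epsilon>\<close>, and the residue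
  class is detected by characters. The final correction removes the point m = l, which lies in the
  class exactly when 3 divides l.\<close>

lemma fibre_sum_0_tendsto:
  assumes "a \<ge> 1" "l \<ge> 1"
  defines "\<epsilon> \<equiv> (-1) ^ a"
  shows "fibre_sum a 0 l \<longlonglongrightarrow> 1 / 3 * ((1 + \<epsilon>) * lerch3 0 a + (\<omega> ^ l + \<epsilon> * \<omega> ^ (2 * l)) * lerch3 1 a
      + (\<omega> ^ (2 * l) + \<epsilon> * \<omega> ^ l) * lerch3 2 a) - (if 3 dvd l then 1 / of_nat l ^ a else 0)"
    (is "_ \<longlonglongrightarrow> ?L - ?I")
proof -
  define g where "g = (\<lambda>m. if 3 dvd m + int l then 1 / of_int m ^ a else (0::complex))"
  define t where "t = (\<lambda>k. g (int (Suc k)) + g (- int (Suc k)))"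
  \<comment> \<open>The window reaches \<open>l\<close> further to the right than to the left, so
    \<open>l\<close> positive terms remain unpaired.\<close>
  have split: "fibre_sum a 0 l N = (\<Sum>k<N. t k) + (\<Sum>i<l. g (int (Suc (N + i)))) - ?I" for N
  proof -
    let ?M = "{- int N..int l + int N}"
    have "fibre_sum a 0 l N = sum g (?M - {0} - {int l})"
      unfolding fibre_sum_def g_def fibre_def
      by (intro sum.mono_neutral_cong_left) auto
    also have "\<dots> = sum g (?M - {0}) - g (int l)"
      using assms by (subst sum_diff1) auto
    also have "g (int l) = ?I"
    proof -
      have "3 dvd int l + int l \<longleftrightarrow> 3 dvd l" by presburger
      thus ?thesis by (simp add: g_def)
    qed
    also have "?M - {0} = {1..int l + int N} \<union> {- int N..-1}" by auto
    also have "sum g \<dots> = sum g {1..int l + int N} + sum g {- int N..-1}"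
      by (rule sum.union_disjoint) auto
    also have "sum g {1..int l + int N} = (\<Sum>k<N + l. g (int (Suc k)))"
      by (rule sum.reindex_bij_witness[of _ "\<lambda>k. int (Suc k)" "\<lambda>m. nat (m - 1)"]) auto
    also have "sum g {- int N..-1} = (\<Sum>k<N. g (- int (Suc k)))"
      by (rule sum.reindex_bij_witness[of _ "\<lambda>k. - int (Suc k)" "\<lambda>m. nat (- m - 1)"]) auto
    finally show ?thesis
      by (simp add: sum_lessThan_add t_def sum.distrib algebra_simps del: of_nat_Suc)
  qed
  have t: "t k = 1 / 3 * ((1 + \<epsilon>) * (\<omega> ^ (0 * Suc k) / of_nat (Suc k) ^ a)
      + (\<omega> ^ l + \<epsilon> * \<omega> ^ (2 * l)) * (\<omega> ^ (1 * Suc k) / of_nat (Suc k) ^ a)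
      + (\<omega> ^ (2 * l) + \<epsilon> * \<omega> ^ l) * (\<omega> ^ (2 * Suc k) / of_nat (Suc k) ^ a))" for k
  proof -
    define n where "n = Suc k"
    have n: "of_nat n \<noteq> (0::complex)" by (simp add: n_def del: of_nat_Suc)
    have d1: "3 dvd int n + int l \<longleftrightarrow> 3 dvd n + l" by presburger
    \<comment> \<open>Adding 3n replaces the difference by a natural number, which can serve as an
      exponent of \<open>\<omega>\<close>.\<close>
    have d2: "3 dvd int l - int n \<longleftrightarrow> 3 dvd l + 2 * n" by presburger
    have "\<omega> ^ (4 * n) = \<omega> ^ n * (\<omega> ^ 3) ^ n"
      by (simp add: add_ac flip: power_mult power_add)
    hence "\<omega> ^ (2 * (l + 2 * n)) = \<omega> ^ (2 * l) * \<omega> ^ n"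
      by (simp add: omega_cube power_add)
    hence o2: "1 + \<omega> ^ l * \<omega> ^ (2 * n) + \<omega> ^ (2 * l) * \<omega> ^ n = (if 3 dvd l + 2 * n then 3 else 0)"
      using omega_orthogonality[of "l + 2 * n"] by (simp only: power_add)
    have o1: "1 + \<omega> ^ n * \<omega> ^ l + \<omega> ^ (2 * n) * \<omega> ^ (2 * l) = (if 3 dvd n + l then 3 else 0)"
      using omega_orthogonality[of "n + l"] by (simp add: power_add algebra_simps)
    have "g (int n) = (if 3 dvd n + l then 3 else 0) / 3 / of_nat n ^ a"
      by (simp add: g_def d1)
    moreover have "g (- int n) = \<epsilon> * (if 3 dvd l + 2 * n then 3 else 0) / 3 / of_nat n ^ a"
      by (cases "even a") (simp_all add: g_def d2 \<epsilon>_def)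
    ultimately have "t k = ((1 + \<omega> ^ n * \<omega> ^ l + \<omega> ^ (2 * n) * \<omega> ^ (2 * l))
        + \<epsilon> * (1 + \<omega> ^ l * \<omega> ^ (2 * n) + \<omega> ^ (2 * l) * \<omega> ^ n)) / 3 / of_nat n ^ a"
      unfolding t_def o1 o2 n_def[symmetric] by (simp add: add_divide_distrib)
    also have "\<dots> = 1 / 3 * ((1 + \<epsilon>) * (\<omega> ^ (0 * n) / of_nat n ^ a)
      + (\<omega> ^ l + \<epsilon> * \<omega> ^ (2 * l)) * (\<omega> ^ (1 * n) / of_nat n ^ a)
      + (\<omega> ^ (2 * l) + \<epsilon> * \<omega> ^ l) * (\<omega> ^ (2 * n) / of_nat n ^ a))"
      using n by (simp add: divide_simps) (simp add: algebra_simps)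
    finally show ?thesis unfolding n_def .
  qed
  \<comment> \<open>For \<open>a = 1\<close> the series with \<open>h = 0\<close> is the divergent
    harmonic one, but then \<open>1 + \<epsilon>\<close> is 0 and both sides vanish.\<close>
  have zero: "(\<lambda>k. (1 + \<epsilon>) * (\<omega> ^ (0 * Suc k) / of_nat (Suc k) ^ a)) sums ((1 + \<epsilon>) * lerch3 0 a)"
  proof (cases "a = 1")
    case False
    thus ?thesis using assms by (intro sums_mult lerch3_sums) auto
  qed (simp add: \<epsilon>_def)
  have "t sums ?L"
    unfolding t using assms(1) by (intro zero sums_add sums_mult[of _ _ "1 / 3"] sums_mult[OF lerch3_sums]) auto
  \<comment> \<open>Disposes of the unpaired terms: their number \<open>l\<close> is fixed and each
    tends to 0.\<close>
  moreover have "(\<lambda>k. g (int (Suc k))) \<longlonglongrightarrow> 0"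
  proof (rule Lim_null_comparison[OF _ LIMSEQ_inverse_real_of_nat])
    have "norm (g (int (Suc k))) \<le> inverse (real (Suc k))" for k
    proof -
      have "real (Suc k) ^ 1 \<le> real (Suc k) ^ a"
        using assms by (intro power_increasing) auto
      hence "1 / real (Suc k) ^ a \<le> 1 / real (Suc k)"
        by (intro divide_left_mono) auto
      thus ?thesis
        by (simp add: g_def norm_divide norm_power inverse_eq_divide del: of_nat_Suc)
    qed
    thus "\<forall>\<^sub>F k in sequentially. norm (g (int (Suc k))) \<le> inverse (real (Suc k))" by simp
  qed
  hence "(\<lambda>N. \<Sum>i<l. g (int (Suc (N + i)))) \<longlonglongrightarrow> 0"
    by (intro tendsto_null_sum) (rule LIMSEQ_ignore_initial_segment)
  ultimately have "(\<lambda>N. (\<Sum>k<N. t k) + (\<Sum>i<l. g (int (Suc (N + i)))) - ?I) \<longlonglongrightarrow> ?L + 0 - ?I"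
    unfolding sums_def by (intro tendsto_intros)
  thus ?thesis unfolding split[abs_def] by simp
qed

section \<open>The target ring and the evaluation of series over fibres\<close>

definition lerch_ring :: "complex set" where
  "lerch_ring = adjoin (adjoin \<rat> {complex_of_real pi, \<i>}) lerch_values"

lemma subsemiring_Rats: "subsemiring (\<rat> :: complex set)"
  by (simp add: subsemiring_def)

lemma subsemiring_lerch_ring: "subsemiring lerch_ring"
  unfolding lerch_ring_def by (intro subsemiring_adjoin subsemiring_Rats)

lemma lerch_ring_add: "x \<in> lerch_ring \<Longrightarrow> y \<in> lerch_ring \<Longrightarrow> x + y \<in> lerch_ring"
  and lerch_ring_mult: "x \<in> lerch_ring \<Longrightarrow> y \<in> lerch_ring \<Longrightarrow> x * y \<in> lerch_ring"
  using subsemiring_lerch_ring by (simp_all add: subsemiring_def)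

lemma Rats_subset_lerch_ring: "\<rat> \<subseteq> lerch_ring"
  unfolding lerch_ring_def
  using base_subset_adjoin subsemiring_adjoin subsemiring_Rats by blast

lemma lerch_ring_diff:
  assumes "x \<in> lerch_ring" "y \<in> lerch_ring"
  shows "x - y \<in> lerch_ring"
proof -
  have "-1 \<in> lerch_ring" using Rats_subset_lerch_ring by (rule subsetD) simp
  thus ?thesis using lerch_ring_add[OF assms(1) lerch_ring_mult[of "-1" y]] assms by simp
qed

lemma lerch3_in_lerch_ring:
  assumes "j \<ge> 1" "h \<in> {0, 1, 2}" "\<not> (j = 1 \<and> h = 0)"
  shows "lerch3 h j \<in> lerch_ring"
proof -
  have "lerch3 h j \<in> lerch_values"
    using assms unfolding lerch3_def lerch_values_def by blast
  thus ?thesis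
    unfolding lerch_ring_def
    using generators_subset_adjoin subsemiring_adjoin subsemiring_Rats by blast
qed

text \<open>The limit depends on l only through powers of \<open>\<omega>\<close> and the correction
  at multiples of 3, so dividing by l^c and summing yields products of two Lerch values, plus single
  values of exponent a + c. Since \<open>c \<ge> 2\<close>, these sums over l converge absolutely
  and \<open>lerch3 0 c\<close> avoids the pole.\<close>

lemma fibre_sum_0_series:
  assumes "a \<ge> 1" "c \<ge> 2"
  obtains V q where "q \<in> lerch_ring" "\<And>l. l \<ge> 1 \<Longrightarrow> fibre_sum a 0 l \<longlonglongrightarrow> V l"
    "((\<lambda>l. V l / of_nat l ^ c) has_sum q) {1..}"
proof -
  define \<epsilon> :: complex where "\<epsilon> = (-1) ^ a"
  define V where "V l = 1 / 3 * ((1 + \<epsilon>) * lerch3 0 a + (\<omega> ^ l + \<epsilon> * \<omega> ^ (2 * l)) * lerch3 1 a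
      + (\<omega> ^ (2 * l) + \<epsilon> * \<omega> ^ l) * lerch3 2 a) - (if 3 dvd l then 1 / of_nat l ^ a else 0)" for l
  define q where "q = 1 / 3 * ((1 + \<epsilon>) * lerch3 0 a * lerch3 0 c +
      lerch3 1 a * (lerch3 1 c + \<epsilon> * lerch3 2 c) + lerch3 2 a * (lerch3 2 c + \<epsilon> * lerch3 1 c))
      - 1 / 3 * (lerch3 0 (a + c) + lerch3 1 (a + c) + lerch3 2 (a + c))"
  have rat: "1 / 3 \<in> lerch_ring" "\<epsilon> \<in> lerch_ring" "1 + \<epsilon> \<in> lerch_ring" "0 \<in> lerch_ring"
    using Rats_subset_lerch_ring by (auto simp: \<epsilon>_def)
  \<comment> \<open>\<open>lerch3 0 1\<close> is not among the generators; for \<open>a = 1\<close>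
    its coefficient is 0.\<close>
  have "(1 + \<epsilon>) * lerch3 0 a \<in> lerch_ring"
  proof (cases "a = 1")
    case True
    thus ?thesis using rat by (simp add: \<epsilon>_def)
  next
    case False
    thus ?thesis using assms by (intro lerch_ring_mult rat lerch3_in_lerch_ring) auto
  qed
  hence "(1 + \<epsilon>) * lerch3 0 a * lerch3 0 c \<in> lerch_ring"
    by (rule lerch_ring_mult) (use assms in \<open>auto intro!: lerch3_in_lerch_ring\<close>)
  hence "q \<in> lerch_ring"
    unfolding q_def using assms
    by (intro rat(1,2) lerch_ring_add lerch_ring_diff lerch_ring_mult[OF rat(1)] lerch_ring_mult[OF rat(2)]
      lerch_ring_mult[OF lerch3_in_lerch_ring] lerch3_in_lerch_ring) auto
  moreover have "fibre_sum a 0 l \<longlonglongrightarrow> V l" if "l \<ge> 1" for l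
    using fibre_sum_0_tendsto[OF assms(1) that] unfolding V_def \<epsilon>_def .
  moreover have "((\<lambda>l. V l / of_nat l ^ c) has_sum q) {1..}"
  proof -
    let ?f = "\<lambda>h j n. \<omega> ^ (h * n) / of_nat n ^ j"
    have "V l / of_nat l ^ c = 1 / 3 * ((1 + \<epsilon>) * lerch3 0 a * ?f 0 c l +
      lerch3 1 a * (?f 1 c l + \<epsilon> * ?f 2 c l) + lerch3 2 a * (?f 2 c l + \<epsilon> * ?f 1 c l))
      + (- 1 / 3) * (?f 0 (a + c) l + ?f 1 (a + c) l + ?f 2 (a + c) l)" if "l \<in> {1..}" for l
    proof -
      \<comment> \<open>Written with characters, the correction becomes a combination of three Lerch
        series of exponent \<open>a + c\<close>.\<close>
      have I: "(if 3 dvd l then 1 / of_nat l ^ a else 0) = (1 + \<omega> ^ l + \<omega> ^ (2 * l)) / 3 / of_nat l ^ a"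
        by (simp add: omega_orthogonality)
      have "of_nat l \<noteq> (0::complex)" using that by simp
      thus ?thesis
        unfolding V_def I by (simp add: divide_simps power_add)
    qed
    moreover have "q = 1 / 3 * ((1 + \<epsilon>) * lerch3 0 a * lerch3 0 c +
      lerch3 1 a * (lerch3 1 c + \<epsilon> * lerch3 2 c) + lerch3 2 a * (lerch3 2 c + \<epsilon> * lerch3 1 c))
      + (- 1 / 3) * (lerch3 0 (a + c) + lerch3 1 (a + c) + lerch3 2 (a + c))"
      by (simp add: q_def)
    moreover have "((\<lambda>l. 1 / 3 * ((1 + \<epsilon>) * lerch3 0 a * ?f 0 c l +
      lerch3 1 a * (?f 1 c l + \<epsilon> * ?f 2 c l) + lerch3 2 a * (?f 2 c l + \<epsilon> * ?f 1 c l))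
      + (- 1 / 3) * (?f 0 (a + c) l + ?f 1 (a + c) l + ?f 2 (a + c) l)) has_sum q) {1..}"
      unfolding calculation(2) using assms
      by (intro has_sum_add has_sum_cmult_right lerch3_has_sum) auto
    ultimately show ?thesis by (subst has_sum_cong) auto
  qed
  ultimately show ?thesis by (rule that)
qed

text \<open>Induction on \<open>a + b\<close>: each partial fraction step lowers one of
  \<open>a\<close>, \<open>b\<close> and raises \<open>c\<close> by one, so \<open>c \<ge> 2\<close>
  holds as soon as one of them reaches 0. The case \<open>a = 0\<close> is reflected to
  \<open>b = 0\<close>.\<close>

lemma fibre_sum_series:
  assumes "a + b \<ge> 1" "c \<ge> 1" "a = 0 \<or> b = 0 \<Longrightarrow> c \<ge> 2"
  shows "\<exists>V q. q \<in> lerch_ring \<and> (\<forall>l\<ge>1. fibre_sum a b l \<longlonglongrightarrow> V l) \<and>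
    ((\<lambda>l. V l / of_nat l ^ c) has_sum q) {1..}"
  using assms
proof (induction "a + b" arbitrary: a b c rule: less_induct)
  case less
  consider "b = 0" | "a = 0" | a' b' where "a = Suc a'" "b = Suc b'"
    by (metis not0_implies_Suc)
  thus ?case
  proof cases
    case 1
    thus ?thesis using fibre_sum_0_series[of a c] less.prems by (metis add_0_right)
  next
    case 2
    have "fibre_sum 0 b = fibre_sum b 0" by (intro ext) (rule fibre_sum_commute)
    thus ?thesis using fibre_sum_0_series[of b c] less.prems 2 by (metis add_0_left)
  next
    case 3
    obtain V1 q1 where 1: "q1 \<in> lerch_ring" "\<forall>l\<ge>1. fibre_sum a' b l \<longlonglongrightarrow> V1 l"
      "((\<lambda>l. V1 l / of_nat l ^ Suc c) has_sum q1) {1..}"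
      using less.hyps[of a' b "Suc c"] less.prems 3 by auto
    obtain V2 q2 where 2: "q2 \<in> lerch_ring" "\<forall>l\<ge>1. fibre_sum a b' l \<longlonglongrightarrow> V2 l"
      "((\<lambda>l. V2 l / of_nat l ^ Suc c) has_sum q2) {1..}"
      using less.hyps[of a b' "Suc c"] less.prems 3 by auto
    have "fibre_sum a b l \<longlonglongrightarrow> (V1 l + V2 l) / of_nat l" if "l \<ge> 1" for l
    proof -
      have "(\<lambda>N. (fibre_sum a' b l N + fibre_sum a b' l N) / of_nat l) \<longlonglongrightarrow> (V1 l + V2 l) / of_nat l"
        using 1 2 that by (intro tendsto_intros) auto
      moreover have "fibre_sum a b l = (\<lambda>N. (fibre_sum a' b l N + fibre_sum a b' l N) / of_nat l)"
        using fibre_sum_Suc_Suc[OF that, of a' b'] 3 by (intro ext) simp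
      ultimately show ?thesis by simp
    qed
    moreover have "((\<lambda>l. (V1 l + V2 l) / of_nat l / of_nat l ^ c) has_sum (q1 + q2)) {1..}"
      using has_sum_add[OF 1(3) 2(3)] by (simp add: add_divide_distrib)
    ultimately show ?thesis
      using lerch_ring_add[OF 1(1) 2(1)] by (intro exI[of _ "\<lambda>l. (V1 l + V2 l) / of_nat l"] exI[of _ "q1 + q2"]) auto
  qed
qed

section \<open>The double series\<close>

definition pu3_index :: "(nat \<times> nat) set" where
  "pu3_index = {(m, n). m \<ge> 1 \<and> n \<ge> 1 \<and> [m = n] (mod 3)}"

definition pu3_term :: "nat \<Rightarrow> nat \<Rightarrow> nat \<Rightarrow> nat \<times> nat \<Rightarrow> complex" where
  "pu3_term a b c = (\<lambda>(p, q). 1 / (of_nat p ^ a * of_nat q ^ b * of_nat (p + q) ^ c))"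

lemma zeta2_PU3_of_nat:
  "zeta2_PU3 (of_nat a, of_nat b, of_nat c) = infsum (pu3_term a b c) pu3_index"
proof -
  have "of_nat n powr of_nat k = (of_nat n ^ k :: complex)" if "n \<ge> 1" for n k :: nat
    using that by (subst powr_nat') auto
  thus ?thesis
    unfolding zeta2_PU3_def pu3_index_def pu3_term_def prod.case
    by (intro infsum_cong) (auto simp del: of_nat_add)
qed

lemma summable_on_powr_three_halves: "(\<lambda>n. 1 / (real n * sqrt (real n))) summable_on {1..}"
proof -
  have "(\<lambda>n. real n powr - (3 / 2)) summable_on UNIV"
    by (rule summable_nonneg_imp_summable_on) (simp_all add: summable_real_powr_iff)
  hence *: "(\<lambda>n. real n powr - (3 / 2)) summable_on {1..}"
    by (rule summable_on_subset) simp
  have "1 / (real n * sqrt (real n)) = real n powr - (3 / 2)" if "n \<in> {1..}" for n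
  proof -
    have "real n powr (3 / 2) = real n powr 1 * real n powr (1 / 2)"
      using powr_add[of "real n" 1 "1 / 2"] by simp
    hence "real n powr (3 / 2) = real n * sqrt (real n)"
      by (simp only: powr_half_sqrt powr_one of_nat_0_le_iff)
    thus ?thesis by (simp only: powr_minus_divide)
  qed
  thus ?thesis using * by (rule summable_on_cong[THEN iffD2])
qed

text \<open>By the inequality of arithmetic and geometric means, p + q is at least sqrt(p q). As all
  exponents are at least 1, the terms are dominated by p^(-3/2) q^(-3/2), a product of two
  convergent series.\<close>

lemma summable_on_pu3_term:
  assumes "a \<ge> 1" "b \<ge> 1" "c \<ge> 1"
  shows "pu3_term a b c summable_on pu3_index"
proof -
  define g where "g = (\<lambda>n. 1 / (real n * sqrt (real n)))"
  have g: "g summable_on {1..}"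
    unfolding g_def by (rule summable_on_powr_three_halves)
  have "(\<lambda>(p, q). g p * g q) summable_on Sigma {1..} (\<lambda>_. {1..})"
  proof (rule summable_on_SigmaI[where g = "\<lambda>p. g p * infsum g {1..}"])
    show "(\<lambda>p. g p * infsum g {1..}) summable_on {1..}"
      by (intro summable_on_cmult_left g)
    show "((\<lambda>q. case (p, q) of (p, q) \<Rightarrow> g p * g q) has_sum g p * infsum g {1..}) {1..}" for p
      using has_sum_cmult_right[OF has_sum_infsum[OF g]] by simp
  qed (auto simp: g_def)
  hence dominated: "(\<lambda>(p, q). g p * g q) summable_on pu3_index"
    by (rule summable_on_subset) (auto simp: pu3_index_def)
  have bound: "norm (pu3_term a b c x) \<le> (\<lambda>(p, q). g p * g q) x" if x_in: "x \<in> pu3_index" for x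
  proof -
    obtain p q where x: "x = (p, q)" and pq: "p \<ge> 1" "q \<ge> 1"
      using x_in by (cases x) (auto simp: pu3_index_def)
    have pow: "real n \<le> real n ^ k" if "n \<ge> 1" "k \<ge> 1" for n k :: nat
      using power_increasing[of 1 k "real n"] that by simp
    have "sqrt (real p) * sqrt (real q) \<le> real (p + q)"
      using arith_geo_mean_sqrt[of "real p" "real q"] by (simp add: real_sqrt_mult)
    also have "\<dots> \<le> real (p + q) ^ c" using pq assms by (intro pow) auto
    finally have "(real p * real q) * (sqrt (real p) * sqrt (real q)) \<le>
        (real p ^ a * real q ^ b) * real (p + q) ^ c"
      using pq assms by (intro mult_mono pow) auto
    hence "1 / (real p ^ a * real q ^ b * real (p + q) ^ c) \<le>
        1 / ((real p * real q) * (sqrt (real p) * sqrt (real q)))"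
      using pq by (intro divide_left_mono) auto
    also have "\<dots> = g p * g q" by (simp add: g_def)
    finally show ?thesis
      by (simp add: x pu3_term_def norm_divide norm_mult norm_power del: of_nat_add)
  qed
  show ?thesis
    by (rule abs_summable_summable, rule Infinite_Sum.abs_summable_on_comparison_test'[OF dominated]) (rule bound)
qed

section \<open>The sum over all fibres, computed in two ways\<close>

definition fibre_term :: "nat \<Rightarrow> nat \<Rightarrow> nat \<Rightarrow> nat \<Rightarrow> int \<Rightarrow> complex" where
  "fibre_term a b c l m = 1 / (of_int m ^ a * of_int (int l - m) ^ b) / of_nat l ^ c"

text \<open>The triple (m, l - m, l) is (p, q, p + q) for 0 < m < l, (p + q, -p, q) for m > l, and
  (-q, p + q, p) for m < 0, with (p, q) in \<open>pu3_index\<close> each time. The negative entry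
  accounts for the sign.\<close>

lemma fibre_term_has_sum:
  assumes "a \<ge> 1" "b \<ge> 1" "c \<ge> 1"
  shows "((\<lambda>(l, m). fibre_term a b c l m) has_sum
    (infsum (pu3_term a b c) pu3_index + (-1) ^ b * infsum (pu3_term b c a) pu3_index
      + (-1) ^ a * infsum (pu3_term c a b) pu3_index)) (Sigma {1..} fibre)"
proof -
  let ?F = "\<lambda>(l, m). fibre_term a b c l m"
  let ?S1 = "{(l, m) \<in> Sigma {1..} fibre. 0 < m \<and> m < int l}"
  let ?S2 = "{(l, m) \<in> Sigma {1..} fibre. int l < m}"
  let ?S3 = "{(l, m) \<in> Sigma {1..} fibre. m < 0}"
  have transfer: "(?F has_sum s) S"
    if "bij_betw f pu3_index S" "\<And>x. ?F (f x) = t x" "(t has_sum s) pu3_index" for f S t s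
  proof -
    have "(\<lambda>x. ?F (f x)) = t" using that(2) by (rule ext)
    thus ?thesis using has_sum_reindex_bij_betw[OF that(1), of ?F s] that(3) by (simp only:)
  qed
  note sum = has_sum_infsum[OF summable_on_pu3_term]
  have sign: "(- of_nat n) ^ k = (-1) ^ k * (of_nat n ^ k :: complex)"
    "1 / ((-1) ^ k * x) = (-1) ^ k / x" for x :: complex and n k
    by (rule power_minus) (cases "even k"; simp)
  have cong: "[p = q] (mod 3) \<longleftrightarrow> 3 dvd int p - int q" for p q :: nat
    by (metis cong_iff_dvd_diff cong_int_iff of_nat_numeral)
  \<comment> \<open>The fibre condition 3 | m + l in the coordinates of each of the three
    regions.\<close>
  have "3 dvd x - y \<longleftrightarrow> 3 dvd x + (x + y)" "3 dvd x - y \<longleftrightarrow> 3 dvd x + y + y"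
    "3 dvd x - y \<longleftrightarrow> 3 dvd - y + x" for x y :: int
    by presburger+
  hence index_iff:
    "(p, q) \<in> pu3_index \<longleftrightarrow> p \<ge> 1 \<and> q \<ge> 1 \<and> 3 dvd int p + int (p + q)"
    "(p, q) \<in> pu3_index \<longleftrightarrow> p \<ge> 1 \<and> q \<ge> 1 \<and> 3 dvd int p + int q + int q"
    "(p, q) \<in> pu3_index \<longleftrightarrow> p \<ge> 1 \<and> q \<ge> 1 \<and> 3 dvd - int q + int p" for p q
    by (simp_all only: pu3_index_def cong mem_Collect_eq prod.case of_nat_add)
  have "bij_betw (\<lambda>(p, q). (p + q, int p)) pu3_index ?S1"
    unfolding bij_betw_def
  proof (intro conjI subset_antisym subsetI)
    show "inj_on (\<lambda>(p, q). (p + q, int p)) pu3_index" by (auto simp: inj_on_def)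
  next
    fix x assume "x \<in> (\<lambda>(p, q). (p + q, int p)) ` pu3_index"
    then obtain p q where "(p, q) \<in> pu3_index" "x = (p + q, int p)" by auto
    thus "x \<in> ?S1" unfolding index_iff(1) fibre_def by simp
  next
    fix x assume "x \<in> ?S1"
    then obtain l m where x: "x = (l, m)" "l \<ge> 1" "3 dvd m + int l" "0 < m" "m < int l"
      by (auto simp: fibre_def)
    define p q where "p = nat m" and "q = l - nat m"
    have *: "m = int p" "l = p + q" "p \<ge> 1" "q \<ge> 1"
      using x by (auto simp: p_def q_def)
    have "(p, q) \<in> pu3_index"
      using x(3) * unfolding index_iff(1) by simp
    thus "x \<in> (\<lambda>(p, q). (p + q, int p)) ` pu3_index"
      by (intro image_eqI[of _ _ "(p, q)"]) (simp_all add: x(1) *)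
  qed
  hence 1: "(?F has_sum infsum (pu3_term a b c) pu3_index) ?S1"
  proof (rule transfer)
    show "?F (case x of (p, q) \<Rightarrow> (p + q, int p)) = pu3_term a b c x" for x
      by (cases x) (simp add: fibre_term_def pu3_term_def)
    show "(pu3_term a b c has_sum infsum (pu3_term a b c) pu3_index) pu3_index"
      using assms by (intro sum)
  qed
  have "bij_betw (\<lambda>(p, q). (q, int p + int q)) pu3_index ?S2"
    unfolding bij_betw_def
  proof (intro conjI subset_antisym subsetI)
    show "inj_on (\<lambda>(p, q). (q, int p + int q)) pu3_index" by (auto simp: inj_on_def)
  next
    fix x assume "x \<in> (\<lambda>(p, q). (q, int p + int q)) ` pu3_index"
    then obtain p q where "(p, q) \<in> pu3_index" "x = (q, int p + int q)" by auto
    thus "x \<in> ?S2" unfolding index_iff(2) fibre_def by simp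
  next
    fix x assume "x \<in> ?S2"
    then obtain l m where x: "x = (l, m)" "l \<ge> 1" "3 dvd m + int l" "int l < m"
      by (auto simp: fibre_def)
    define p q where "p = nat m - l" and "q = l"
    have *: "m = int p + int q" "l = q" "p \<ge> 1" "q \<ge> 1"
      using x by (auto simp: p_def q_def)
    have "(p, q) \<in> pu3_index"
      using x(3) * unfolding index_iff(2) by simp
    thus "x \<in> (\<lambda>(p, q). (q, int p + int q)) ` pu3_index"
      by (intro image_eqI[of _ _ "(p, q)"]) (simp_all add: x(1) *)
  qed
  hence 2: "(?F has_sum (-1) ^ b * infsum (pu3_term b c a) pu3_index) ?S2"
  proof (rule transfer)
    show "?F (case x of (p, q) \<Rightarrow> (q, int p + int q)) = (-1) ^ b * pu3_term b c a x" for x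
      by (cases x) (simp add: fibre_term_def pu3_term_def sign mult_ac)
    show "((\<lambda>x. (-1) ^ b * pu3_term b c a x) has_sum (-1) ^ b * infsum (pu3_term b c a) pu3_index) pu3_index"
      using assms by (intro has_sum_cmult_right sum)
  qed
  have "bij_betw (\<lambda>(p, q). (p, - int q)) pu3_index ?S3"
    unfolding bij_betw_def
  proof (intro conjI subset_antisym subsetI)
    show "inj_on (\<lambda>(p, q). (p, - int q)) pu3_index" by (auto simp: inj_on_def)
  next
    fix x assume "x \<in> (\<lambda>(p, q). (p, - int q)) ` pu3_index"
    then obtain p q where "(p, q) \<in> pu3_index" "x = (p, - int q)" by auto
    thus "x \<in> ?S3" unfolding index_iff(3) fibre_def by simp
  next
    fix x assume "x \<in> ?S3"
    then obtain l m where x: "x = (l, m)" "l \<ge> 1" "3 dvd m + int l" "m < 0"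
      by (auto simp: fibre_def)
    define p q where "p = l" and "q = nat (- m)"
    have *: "m = - int q" "l = p" "p \<ge> 1" "q \<ge> 1"
      using x by (auto simp: p_def q_def)
    have "(p, q) \<in> pu3_index"
      using x(3) * unfolding index_iff(3) by simp
    thus "x \<in> (\<lambda>(p, q). (p, - int q)) ` pu3_index"
      by (intro image_eqI[of _ _ "(p, q)"]) (simp_all add: x(1) *)
  qed
  hence 3: "(?F has_sum (-1) ^ a * infsum (pu3_term c a b) pu3_index) ?S3"
  proof (rule transfer)
    show "?F (case x of (p, q) \<Rightarrow> (p, - int q)) = (-1) ^ a * pu3_term c a b x" for x
      by (cases x) (simp add: fibre_term_def pu3_term_def sign mult_ac)
    show "((\<lambda>x. (-1) ^ a * pu3_term c a b x) has_sum (-1) ^ a * infsum (pu3_term c a b) pu3_index) pu3_index"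
      using assms by (intro has_sum_cmult_right sum)
  qed
  have "((\<lambda>(l, m). fibre_term a b c l m) has_sum
    (infsum (pu3_term a b c) pu3_index + (-1) ^ b * infsum (pu3_term b c a) pu3_index
      + (-1) ^ a * infsum (pu3_term c a b) pu3_index)) (?S1 \<union> ?S2 \<union> ?S3)"
    by (intro has_sum_Un_disjoint 1 2 3) auto
  also have "?S1 \<union> ?S2 \<union> ?S3 = Sigma {1..} fibre"
    by (auto simp: fibre_def)
  finally show ?thesis .
qed

text \<open>The family is summable over all pairs (l, m), so it may be summed fibre by fibre. The
  inner sums are the limits from \<open>fibre_sum_series\<close>, and uniqueness of the outer sum
  identifies the signed combination with an element of the ring.\<close>

lemma cyclic_relation:
  assumes "a \<ge> 1" "b \<ge> 1" "c \<ge> 1"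
  shows "infsum (pu3_term a b c) pu3_index + (-1) ^ b * infsum (pu3_term b c a) pu3_index
      + (-1) ^ a * infsum (pu3_term c a b) pu3_index \<in> lerch_ring" (is "?R \<in> _")
proof -
  note F = fibre_term_has_sum[OF assms]
  obtain V q where q: "q \<in> lerch_ring" and V: "\<forall>l\<ge>1. fibre_sum a b l \<longlonglongrightarrow> V l"
    and Vq: "((\<lambda>l. V l / of_nat l ^ c) has_sum q) {1..}"
    using fibre_sum_series[of a b c] assms by auto
  have "((\<lambda>m. fibre_term a b c l m) has_sum V l / of_nat l ^ c) (fibre l)" if l: "l \<in> {1..}" for l
  proof -
    have "(\<lambda>(l, m). fibre_term a b c l m) summable_on Sigma {1..} fibre"
      using F by (rule has_sum_imp_summable)
    hence "(fibre_term a b c l) summable_on fibre l"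
      using l by (rule summable_on_SigmaD1)
    then obtain s where s: "(fibre_term a b c l has_sum s) (fibre l)"
      unfolding summable_on_def by blast
    \<comment> \<open>The windows eventually contain every finite subset of the fibre, so the
      unordered sum is the limit of the truncated sums.\<close>
    have "filterlim (\<lambda>N. fibre l \<inter> {- int N..int l + int N}) (finite_subsets_at_top (fibre l)) sequentially"
      unfolding filterlim_finite_subsets_at_top
    proof safe
      fix X assume X: "finite X" "X \<subseteq> fibre l"
      obtain M where M: "\<And>x. x \<in> X \<Longrightarrow> \<bar>x\<bar> \<le> M"
        using X(1) Max_ge[of "abs ` X"] by blast
      show "\<forall>\<^sub>F N in sequentially. finite (fibre l \<inter> {- int N..int l + int N}) \<and>
          X \<subseteq> fibre l \<inter> {- int N..int l + int N} \<and>
          fibre l \<inter> {- int N..int l + int N} \<subseteq> fibre l"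
        using eventually_ge_at_top[of "nat M"]
      proof eventually_elim
        case (elim N)
        have "- int N \<le> x \<and> x \<le> int l + int N" if "x \<in> X" for x
          using M[OF that] elim by linarith
        thus ?case using X by auto
      qed
    qed
    hence "(\<lambda>N. sum (fibre_term a b c l) (fibre l \<inter> {- int N..int l + int N})) \<longlonglongrightarrow> s"
      using s unfolding has_sum_def by (rule filterlim_compose[rotated])
    hence "(\<lambda>N. fibre_sum a b l N / of_nat l ^ c) \<longlonglongrightarrow> s"
      by (simp add: fibre_sum_def fibre_term_def sum_divide_distrib)
    moreover have "(\<lambda>N. fibre_sum a b l N / of_nat l ^ c) \<longlonglongrightarrow> V l / of_nat l ^ c"
      using V l by (intro tendsto_intros) auto
    ultimately have "s = V l / of_nat l ^ c" by (rule LIMSEQ_unique)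
    with s show ?thesis by simp
  qed
  hence "((\<lambda>l. V l / of_nat l ^ c) has_sum ?R) {1..}"
    by (intro has_sum_SigmaD[OF F]) simp
  hence "?R = q" using Vq has_sum_unique by blast
  thus ?thesis using q by simp
qed

theorem theorem6p1:
  fixes a b c :: nat
  assumes "a \<ge> 1" "b \<ge> 1" "c \<ge> 1"
    and "odd (a + b + c)"
  shows "zeta2_PU3 (of_nat a, of_nat b, of_nat c)
    \<in> adjoin (adjoin \<rat> {complex_of_real pi, \<i>}) lerch_values"
proof -
  define X Y Z where "X = infsum (pu3_term a b c) pu3_index"
    and "Y = infsum (pu3_term b c a) pu3_index" and "Z = infsum (pu3_term c a b) pu3_index"
  define u v w :: complex where "u = (-1) ^ a" and "v = (-1) ^ b" and "w = (-1) ^ c"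
  have sq: "v * v = 1" "w * w = 1"
    unfolding v_def w_def by (simp_all flip: power_mult_distrib)
  \<comment> \<open>The product is (-1)^(a + b + c); this is where the parity hypothesis
    enters.\<close>
  have odd: "u * v * w = -1"
    using assms(4) unfolding u_def v_def w_def by (simp only: flip: power_add) simp
  have "v / 2 \<in> lerch_ring"
    unfolding v_def using Rats_subset_lerch_ring by (rule subsetD) (intro Rats_divide Rats_power; simp)
  moreover have "w \<in> lerch_ring"
    unfolding w_def using Rats_subset_lerch_ring by (rule subsetD) (intro Rats_power; simp)
  moreover have "Y + w * Z + v * X \<in> lerch_ring" "Z + u * X + w * Y \<in> lerch_ring"
    unfolding X_def Y_def Z_def u_def v_def w_def
    using cyclic_relation[of b c a] cyclic_relation[of c a b] assms(1-3) by blast+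
  \<comment> \<open>Subtracting \<open>w\<close> times the second relation cancels \<open>Z\<close>,
    and also \<open>Y\<close> because \<open>w * w = 1\<close>. What remains is (v - u w) X, and
    multiplying by \<open>v\<close> turns the coefficient into 1 - u v w = 2.\<close>
  ultimately have "v / 2 * ((Y + w * Z + v * X) - w * (Z + u * X + w * Y)) \<in> lerch_ring"
    by (intro lerch_ring_mult[of "v / 2"] lerch_ring_mult[of w] lerch_ring_diff)
  also have "v / 2 * ((Y + w * Z + v * X) - w * (Z + u * X + w * Y))
      = (v * v - u * v * w) / 2 * X + v / 2 * (1 - w * w) * Y"
    by (simp add: field_simps)
  also have "\<dots> = X"
    by (simp add: sq odd)
  finally show ?thesis
    unfolding zeta2_PU3_of_nat X_def lerch_ring_def .
qed

end
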